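(* Let $m\geq 2$ be an even integer. Then $3\leq\chi_{la}(K_{1,m,m})\leq 4$.
   Context: All graphs are simple and finite. Let $G=(V,E)$ be a graph without isolated vertices. For a bijection $f:E\to\{1,2,\dots,|E|\}$ and a vertex $u$, the weight of $u$ is $w(u)=\sum_{e\in E(u)}f(e)$, where $E(u)$ is the set of edges incident to $u$. The bijection $f$ is a local antimagic labeling of $G$ if $w(u)\neq w(v)$ for every edge $uv\in E$; it then induces a proper vertex coloring of $G$ in which $v$ gets color $w(v)$. The local antimagic chromatic number $\chi_{la}(G)$ is the minimum number of distinct colors (distinct values of $w$) over all local antimagic labelings of $G$. $K_{1,m,m}$ is the complete tripartite graph with parts of sizes $1$, $m$ and $m$. *)

theory Defs
  imports Main
begin

text \<open>A graph is a pair of a vertex set and a set of edges, an edge being an unordered pair of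
  distinct vertices.\<close>

type_synonym 'a ugraph = "'a set \<times> 'a set set"

abbreviation verts :: "'a ugraph \<Rightarrow> 'a set" where
  "verts G \<equiv> fst G"

abbreviation edges :: "'a ugraph \<Rightarrow> 'a set set" where
  "edges G \<equiv> snd G"

definition simple_graph :: "'a ugraph \<Rightarrow> bool" where
  "simple_graph G \<longleftrightarrow> finite (verts G) \<and>
     (\<forall>e\<in>edges G. \<exists>u\<in>verts G. \<exists>v\<in>verts G. u \<noteq> v \<and> e = {u, v})"

definition incident_edges :: "'a ugraph \<Rightarrow> 'a \<Rightarrow> 'a set set" where
  "incident_edges G u = {e \<in> edges G. u \<in> e}"

definition no_isolated_vertices :: "'a ugraph \<Rightarrow> bool" where
  "no_isolated_vertices G \<longleftrightarrow> (\<forall>u\<in>verts G. incident_edges G u \<noteq> {})"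

definition weight :: "'a ugraph \<Rightarrow> ('a set \<Rightarrow> nat) \<Rightarrow> 'a \<Rightarrow> nat" where
  "weight G f u = (\<Sum>e\<in>incident_edges G u. f e)"

definition local_antimagic_labeling :: "'a ugraph \<Rightarrow> ('a set \<Rightarrow> nat) \<Rightarrow> bool" where
  "local_antimagic_labeling G f \<longleftrightarrow>
     bij_betw f (edges G) {1..card (edges G)} \<and>
     (\<forall>u v. {u, v} \<in> edges G \<longrightarrow> weight G f u \<noteq> weight G f v)"

text \<open>The infimum is taken in the natural numbers, so it is attained as soon as the graph has a
  local antimagic labeling; for a graph without one the value is \<open>0\<close>. Hence a positive lower
  bound on it includes the existence of a local antimagic labeling.\<close>

definition chi_la :: "'a ugraph \<Rightarrow> nat" where
  "chi_la G = Inf {card (weight G f ` verts G) | f. local_antimagic_labeling G f}"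

text \<open>The vertex \<open>(i, j)\<close> is the \<open>j\<close>-th vertex of the \<open>i\<close>-th part.\<close>

definition complete_tripartite :: "nat \<Rightarrow> nat \<Rightarrow> nat \<Rightarrow> (nat \<times> nat) ugraph" where
  "complete_tripartite a b c =
     (let V = {0} \<times> {..<a} \<union> {1} \<times> {..<b} \<union> {2} \<times> {..<c}
      in (V, {{u, v} | u v. u \<in> V \<and> v \<in> V \<and> fst u \<noteq> fst v}))"

lemma simple_graph_complete_tripartite: "simple_graph (complete_tripartite a b c)"
proof -
  have "\<exists>u\<in>verts (complete_tripartite a b c). \<exists>v\<in>verts (complete_tripartite a b c).
      u \<noteq> v \<and> e = {u, v}"
    if e: "e \<in> edges (complete_tripartite a b c)" for e
  proof -
    from e obtain u v where "e = {u, v}" "u \<in> verts (complete_tripartite a b c)"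
      "v \<in> verts (complete_tripartite a b c)" "fst u \<noteq> fst v"
      unfolding complete_tripartite_def Let_def fst_conv snd_conv mem_Collect_eq by metis
    then show ?thesis by metis
  qed
  moreover have "finite (verts (complete_tripartite a b c))"
    by (simp add: complete_tripartite_def)
  ultimately show ?thesis unfolding simple_graph_def by metis
qed

lemma no_isolated_vertices_complete_tripartite:
  assumes "a > 0" "b > 0"
  shows "no_isolated_vertices (complete_tripartite a b c)"
  unfolding no_isolated_vertices_def
proof
  fix u assume u: "u \<in> verts (complete_tripartite a b c)"
  define v :: "nat \<times> nat" where "v = (if fst u = 0 then (1, 0) else (0, 0))"
  have "v \<in> verts (complete_tripartite a b c)" "fst u \<noteq> fst v"
    using assms by (simp_all add: v_def complete_tripartite_def)
  with u have "{u, v} \<in> edges (complete_tripartite a b c)"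
    unfolding complete_tripartite_def Let_def fst_conv snd_conv mem_Collect_eq by metis
  then have "{u, v} \<in> incident_edges (complete_tripartite a b c) u"
    by (simp add: incident_edges_def)
  then show "incident_edges (complete_tripartite a b c) u \<noteq> {}" by (metis empty_iff)
qed

end

theory Submission
  imports Defs "HOL-Number_Theory.Cong"
begin

text \<open>Put \<open>n = m + 1\<close>, let row and column \<open>0\<close> of an \<open>n \<times> n\<close> array both stand for the apex, the
  other rows and columns for the two large parts, so that cell \<open>(i, j) \<noteq> (0, 0)\<close> is an edge.
  As \<open>n\<close> is odd, the orthogonal Latin squares \<open>i + j\<close> and \<open>i + 2j\<close> modulo \<open>n\<close> combine to a square
  with entries \<open>0, \<dots>, n\<^sup>2 - 1\<close>, with all row and column sums equal to some \<open>M\<close>, and with \<open>0\<close> in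
  the corner. Its column \<open>0\<close> is \<open>(n + 1) i\<close>; exchanging the entries of rows \<open>2k - 1\<close> and \<open>2k\<close>
  there changes the row sums to \<open>M \<plusminus> (n + 1)\<close> and leaves the column sums at \<open>M\<close> and the apex
  at \<open>2M\<close>. The lower bound comes from a triangle.\<close>

section \<open>The labeling as a square array\<close>

definition latin_entry :: "nat \<Rightarrow> nat \<Rightarrow> nat \<Rightarrow> nat" where
  "latin_entry n i j = n * ((i + j) mod n) + (i + 2 * j) mod n"

definition swap_pairs :: "nat \<Rightarrow> nat" where
  "swap_pairs i = (if i = 0 then 0 else if odd i then i + 1 else i - 1)"

definition cell_label :: "nat \<Rightarrow> nat \<Rightarrow> nat \<Rightarrow> nat" where
  "cell_label n i j = latin_entry n (if j = 0 then swap_pairs i else i) j"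

text \<open>Positive indices are shifted down by one because index 0 is taken by the apex. The cell
  \<open>(0, 0)\<close> would give the singleton of the apex, which is not an edge; hence its
  removal below.\<close>

definition cell_edge :: "nat \<times> nat \<Rightarrow> (nat \<times> nat) set" where
  "cell_edge = (\<lambda>(i, j). {if i = 0 then (0, 0) else (1, i - 1), if j = 0 then (0, 0) else (2, j - 1)})"

text \<open>An edge has at most one endpoint in part 1, so the sum just reads off its row number, or
  0 if there is none. Together with \<open>edge_col\<close> this decodes a cell from an unordered
  edge.\<close>

definition edge_row :: "(nat \<times> nat) set \<Rightarrow> nat" where
  "edge_row e = (\<Sum>v\<in>e. if fst v = 1 then snd v + 1 else 0)"

definition edge_col :: "(nat \<times> nat) set \<Rightarrow> nat" where
  "edge_col e = (\<Sum>v\<in>e. if fst v = 2 then snd v + 1 else 0)"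

definition tripartite_label :: "nat \<Rightarrow> (nat \<times> nat) set \<Rightarrow> nat" where
  "tripartite_label n e = cell_label n (edge_row e) (edge_col e)"

text \<open>An injective self-map of a finite set is a permutation. This serves each digit along a
  line of the array, and also \<open>swap_pairs\<close>.\<close>

lemma sum_inj_on_lessThan:
  fixes F :: "nat \<Rightarrow> nat"
  assumes "inj_on F {..<n}" "F ` {..<n} \<subseteq> {..<n}"
  shows "(\<Sum>i<n. F i) = \<Sum>{..<n}"
proof -
  have "F ` {..<n} = {..<n}"
    using assms by (simp add: endo_inj_surj)
  then show ?thesis
    using sum.reindex[OF assms(1), of "\<lambda>x. x"] by simp
qed

text \<open>For odd \<open>n\<close> the largest index is even, so no odd index has the partner
  \<open>n\<close>.\<close>

lemma swap_pairs_lt: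
  assumes "odd n" "i < n"
  shows "swap_pairs i < n"
proof -
  have "i + 1 \<noteq> n" if "odd i"
    using assms that by auto
  then show ?thesis
    using assms by (auto simp: swap_pairs_def)
qed

lemma swap_pairs_swap_pairs [simp]: "swap_pairs (swap_pairs i) = i"
  by (auto simp: swap_pairs_def elim: oddE)

lemma inj_swap_pairs: "inj swap_pairs"
  by (metis injI swap_pairs_swap_pairs)

section \<open>Line sums and distinct entries of the array\<close>

lemma sum_latin_rows:
  assumes "odd n"
  shows "(\<Sum>j<n. latin_entry n i j) = (n + 1) * \<Sum>{..<n}"
proof -
  have n: "n > 0" using assms by (cases n) auto
  \<comment> \<open>Oddness makes 2 invertible modulo \<open>n\<close>, so \<open>i + 2 * j\<close>
    runs through all residues as \<open>j\<close> does.\<close>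
  have co: "coprime 2 n" using assms by simp
  have "inj_on (\<lambda>j. (i + j) mod n) {..<n}"
  proof (rule inj_onI)
    fix j k assume "j \<in> {..<n}" "k \<in> {..<n}" "(i + j) mod n = (i + k) mod n"
    then show "j = k"
      using cong_add_lcancel_nat[of i j k n] by (simp add: cong_def)
  qed
  then have A: "(\<Sum>j<n. (i + j) mod n) = \<Sum>{..<n}"
    using n by (intro sum_inj_on_lessThan) auto
  have "inj_on (\<lambda>j. (i + 2 * j) mod n) {..<n}"
  proof (rule inj_onI)
    fix j k assume jk: "j \<in> {..<n}" "k \<in> {..<n}" "(i + 2 * j) mod n = (i + 2 * k) mod n"
    then have "[2 * j = 2 * k] (mod n)"
      using cong_add_lcancel_nat[of i "2 * j" "2 * k" n] by (simp add: cong_def)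
    then have "[j = k] (mod n)"
      using co cong_mult_lcancel_nat[of 2 n j k] by simp
    then show "j = k" using jk by (simp add: cong_def)
  qed
  then have B: "(\<Sum>j<n. (i + 2 * j) mod n) = \<Sum>{..<n}"
    using n by (intro sum_inj_on_lessThan) auto
  show ?thesis
    by (simp add: latin_entry_def sum.distrib A B flip: sum_distrib_left)
qed

text \<open>Along a column both base-\<open>n\<close> digits are translates of the row
  index.\<close>

lemma sum_latin_cols:
  assumes "n > 0"
  shows "(\<Sum>i<n. latin_entry n i j) = (n + 1) * \<Sum>{..<n}"
proof -
  have S: "(\<Sum>i<n. (i + c) mod n) = \<Sum>{..<n}" for c
  proof (rule sum_inj_on_lessThan)
    show "inj_on (\<lambda>i. (i + c) mod n) {..<n}"
    proof (rule inj_onI)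
      fix i k assume "i \<in> {..<n}" "k \<in> {..<n}" "(i + c) mod n = (k + c) mod n"
      then show "i = k"
        using cong_add_rcancel_nat[of i c k n] by (simp add: cong_def)
    qed
  qed (use assms in auto)
  show ?thesis
    by (simp add: latin_entry_def sum.distrib S flip: sum_distrib_left)
qed

lemma latin_entry_col0: "i < n \<Longrightarrow> latin_entry n i 0 = (n + 1) * i"
  by (simp add: latin_entry_def)

text \<open>This is orthogonality: division by \<open>n\<close> recovers both digits, their
  difference modulo \<open>n\<close> is the column, and then the first digit gives the row.\<close>

lemma inj_on_latin_entry: "inj_on (\<lambda>(i, j). latin_entry n i j) ({..<n} \<times> {..<n})"
proof (rule inj_onI, clarsimp)
  fix i j k l
  assume lt: "i < n" "j < n" "k < n" "l < n" and eq: "latin_entry n i j = latin_entry n k l"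
  have dm: "latin_entry n i j div n = (i + j) mod n" "latin_entry n i j mod n = (i + 2 * j) mod n"
    if "n > 0" for i j
    using that by (simp_all add: latin_entry_def)
  have A: "[i + j = k + l] (mod n)" and B: "[i + 2 * j = k + 2 * l] (mod n)"
    using dm[of i j] dm[of k l] eq lt by (simp_all add: cong_def)
  from B have "[(i + j) + j = (k + l) + l] (mod n)" by (simp add: mult_2 add.assoc)
  moreover have "[(i + j) + l = (k + l) + l] (mod n)"
    using A by (simp add: cong_add_rcancel_nat)
  ultimately have "[(i + j) + j = (i + j) + l] (mod n)"
    by (meson cong_sym cong_trans)
  then have "[j = l] (mod n)" by (simp only: cong_add_lcancel_nat)
  then have "j = l" using lt by (simp add: cong_def)
  moreover have "i = k"
    using A lt \<open>j = l\<close> by (simp add: cong_add_rcancel_nat) (simp add: cong_def)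
  ultimately show "i = k \<and> j = l" by simp
qed

text \<open>Injectivity, the range below \<open>n * n\<close> and counting give a bijection onto all
  of \<open>{..<n * n}\<close>; the corner carries 0 and is dropped together with it.\<close>

lemma bij_betw_cell_label:
  assumes "odd n"
  shows "bij_betw (\<lambda>(i, j). cell_label n i j) ({..<n} \<times> {..<n} - {(0, 0)}) {1..n * n - 1}"
proof -
  let ?D = "{..<n} \<times> {..<n}" and ?g = "\<lambda>(i, j). cell_label n i j"
  have n: "n > 0" using assms by (cases n) auto
  have inj: "inj_on ?g ?D"
  proof (rule inj_onI, clarsimp)
    fix i j k l assume lt: "i < n" "j < n" "k < n" "l < n"
      and eq: "cell_label n i j = cell_label n k l"
    \<comment> \<open>The swap acts within a column, so injectivity of the Latin entries first
      yields equal columns; both rows then fall under the same case and the swap can be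
      undone.\<close>
    define i' where "i' = (if j = 0 then swap_pairs i else i)"
    define k' where "k' = (if l = 0 then swap_pairs k else k)"
    have "i' < n" "k' < n"
      using lt assms by (simp_all add: i'_def k'_def swap_pairs_lt)
    moreover have "latin_entry n i' j = latin_entry n k' l"
      using eq by (simp only: cell_label_def i'_def k'_def)
    ultimately have "(i', j) = (k', l)"
      using inj_onD[OF inj_on_latin_entry[of n], of "(i', j)" "(k', l)"] lt by simp
    then show "i = k \<and> j = l"
      by (auto simp: i'_def k'_def split: if_splits dest: injD[OF inj_swap_pairs])
  qed
  have "?g p < n * n" if "p \<in> ?D" for p
  proof -
    obtain i j where p: "p = (i, j)" by force
    have "n * a + b < n * n" if "a < n" "b < n" for a b :: nat
    proof -
      have "n * a + b < n * (a + 1)" using that by simp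
      also have "\<dots> \<le> n * n" using that by (intro mult_le_mono) auto
      finally show ?thesis .
    qed
    then show ?thesis using n by (simp add: p cell_label_def latin_entry_def)
  qed
  then have "?g ` ?D \<subseteq> {..<n * n}" by blast
  moreover have "card (?g ` ?D) = card {..<n * n}"
    using card_image[OF inj] by simp
  ultimately have "?g ` ?D = {..<n * n}"
    by (intro card_subset_eq) auto
  with inj have "bij_betw ?g ?D {..<n * n}" by (simp add: bij_betw_def)
  moreover have "?g (0, 0) = 0"
    by (simp add: cell_label_def latin_entry_def swap_pairs_def)
  ultimately have "bij_betw ?g (?D - {(0, 0)}) ({..<n * n} - {0})"
    using n bij_betw_DiffI[of ?g ?D "{..<n * n}" "{(0, 0)}" "{0}"] by simp
  moreover have "{..<n * n} - {0} = {1..n * n - 1}" by auto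
  ultimately show ?thesis by simp
qed

section \<open>Edges as cells\<close>

lemma edge_row_cell_edge [simp]: "edge_row (cell_edge (i, j)) = i"
  and edge_col_cell_edge [simp]: "edge_col (cell_edge (i, j)) = j"
  by (auto simp: edge_row_def edge_col_def cell_edge_def)

lemma inj_cell_edge: "inj cell_edge"
  by (rule injI) (metis edge_row_cell_edge edge_col_cell_edge surj_pair)

lemma mem_edges_complete_tripartite_iff:
  "e \<in> edges (complete_tripartite a b c) \<longleftrightarrow>
    (\<exists>u v. e = {u, v} \<and> u \<in> verts (complete_tripartite a b c) \<and>
      v \<in> verts (complete_tripartite a b c) \<and> fst u \<noteq> fst v)"
  by (simp only: complete_tripartite_def Let_def fst_conv snd_conv mem_Collect_eq)

lemma edges_complete_tripartite:
  "edges (complete_tripartite 1 m m) = cell_edge ` ({..<Suc m} \<times> {..<Suc m} - {(0, 0)})"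
    (is "?E = ?C")
proof
  show "?C \<subseteq> ?E"
  proof
    fix e assume "e \<in> ?C"
    then obtain p where p: "p \<in> {..<Suc m} \<times> {..<Suc m} - {(0, 0)}" "e = cell_edge p" ..
    obtain i j where "p = (i, j)" by fastforce
    with p have ij: "i < Suc m" "j < Suc m" "(i, j) \<noteq> (0, 0)" "e = cell_edge (i, j)"
      by simp_all
    let ?u = "if i = 0 then (0, 0) else (1, i - 1) :: nat \<times> nat"
    let ?v = "if j = 0 then (0, 0) else (2, j - 1) :: nat \<times> nat"
    have "?u \<in> verts (complete_tripartite 1 m m)" "?v \<in> verts (complete_tripartite 1 m m)"
        "fst ?u \<noteq> fst ?v" "e = {?u, ?v}"
      using ij by (auto simp: complete_tripartite_def cell_edge_def)
    then show "e \<in> ?E"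
      unfolding mem_edges_complete_tripartite_iff by blast
  qed
next
  show "?E \<subseteq> ?C"
  proof
    fix e assume "e \<in> ?E"
    then obtain u' v' where uv': "e = {u', v'}" "u' \<in> verts (complete_tripartite 1 m m)"
        "v' \<in> verts (complete_tripartite 1 m m)" "fst u' \<noteq> fst v'"
      unfolding mem_edges_complete_tripartite_iff by blast
    \<comment> \<open>Ordering the endpoints by part leaves three kinds of edges, namely column 0,
      row 0 and the interior.\<close>
    obtain u v where e: "e = {u, v}" and uv: "u \<in> verts (complete_tripartite 1 m m)"
        "v \<in> verts (complete_tripartite 1 m m)" "fst u < fst v"
    proof (cases "fst u' < fst v'")
      case True
      then show ?thesis using uv' that[of u' v'] by simp
    next
      case False
      then show ?thesis using uv' that[of v' u'] by (simp add: insert_commute)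
    qed
    from uv consider b where "u = (0, 0)" "v = (1, b)" "b < m"
      | b where "u = (0, 0)" "v = (2, b)" "b < m"
      | a b where "u = (1, a)" "v = (2, b)" "a < m" "b < m"
      by (auto simp: complete_tripartite_def)
    then show "e \<in> ?C"
    proof cases
      case (1 b)
      then have "e = cell_edge (Suc b, 0)" "Suc b < Suc m"
        using e by (simp_all add: cell_edge_def insert_commute)
      then show ?thesis by blast
    next
      case (2 b)
      then have "e = cell_edge (0, Suc b)" "Suc b < Suc m"
        using e by (simp_all add: cell_edge_def)
      then show ?thesis by blast
    next
      case (3 a b)
      then have "e = cell_edge (Suc a, Suc b)" "Suc a < Suc m" "Suc b < Suc m"
        using e by (simp_all add: cell_edge_def)
      then show ?thesis by blast
    qed
  qed
qed

section \<open>Vertex weights as sums over cells\<close>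

lemma weight_cells:
  assumes "incident_edges G u = cell_edge ` A"
  shows "weight G (tripartite_label n) u = (\<Sum>(i, j)\<in>A. cell_label n i j)"
proof -
  have "inj_on cell_edge A" by (rule inj_on_subset[OF inj_cell_edge]) simp
  then show ?thesis
    unfolding weight_def assms
    by (subst sum.reindex) (auto simp: tripartite_label_def intro!: sum.cong)
qed

lemma incident_row:
  assumes "i < m"
  shows "incident_edges (complete_tripartite 1 m m) (1, i) = cell_edge ` ({Suc i} \<times> {..<Suc m})"
  unfolding incident_edges_def edges_complete_tripartite
  using assms by (auto simp: cell_edge_def split: if_splits)

lemma incident_col:
  assumes "j < m"
  shows "incident_edges (complete_tripartite 1 m m) (2, j) = cell_edge ` ({..<Suc m} \<times> {Suc j})"
  unfolding incident_edges_def edges_complete_tripartite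
  using assms by (auto simp: cell_edge_def split: if_splits)

lemma incident_apex:
  "incident_edges (complete_tripartite 1 m m) (0, 0) =
    cell_edge ` ({0} \<times> {1..<Suc m} \<union> {1..<Suc m} \<times> {0})"
  unfolding incident_edges_def edges_complete_tripartite
  by (auto simp: cell_edge_def split: if_splits)

text \<open>Only the entry in column 0 departs from the Latin array: in
  \<open>(m + 2) * Suc i\<close>, the index \<open>Suc i\<close> is replaced by its partner. Even
  \<open>i\<close> means an odd row number, whose partner is one larger.\<close>

lemma weight_row:
  assumes "even m" "i < m"
  shows "weight (complete_tripartite 1 m m) (tripartite_label (Suc m)) (1, i) =
    (m + 2) * (if even i then \<Sum>{..<Suc m} + 1 else \<Sum>{..<Suc m} - 1)"
proof -
  let ?n = "Suc m" and ?w = "weight (complete_tripartite 1 m m) (tripartite_label (Suc m)) (1, i)"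
  have n: "odd ?n" using assms by simp
  have "?w = (\<Sum>j<?n. cell_label ?n (Suc i) j)"
    by (subst weight_cells[OF incident_row[OF assms(2)]])
      (simp flip: sum.cartesian_product)
  also have "\<dots> = cell_label ?n (Suc i) 0 + (\<Sum>j\<in>{..<?n} - {0}. latin_entry ?n (Suc i) j)"
    by (subst sum.remove[of _ 0]) (auto simp: cell_label_def intro!: sum.cong)
  finally have w: "?w = (m + 2) * swap_pairs (Suc i)
      + (\<Sum>j\<in>{..<?n} - {0}. latin_entry ?n (Suc i) j)"
    using swap_pairs_lt[OF n, of "Suc i"] assms by (simp add: cell_label_def latin_entry_col0)
  have "(\<Sum>j<?n. latin_entry ?n (Suc i) j) =
      latin_entry ?n (Suc i) 0 + (\<Sum>j\<in>{..<?n} - {0}. latin_entry ?n (Suc i) j)"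
    by (rule sum.remove) auto
  \<comment> \<open>The change is stated additively, since \<open>swap_pairs (Suc i)\<close> may be
    smaller than \<open>Suc i\<close>.\<close>
  then have *: "?w + (m + 2) * Suc i = (m + 2) * \<Sum>{..<?n} + (m + 2) * swap_pairs (Suc i)"
    using w sum_latin_rows[OF n, of "Suc i"] latin_entry_col0[of "Suc i" ?n] assms by simp
  define T where "T = \<Sum>{..<?n}"
  show ?thesis
  proof (cases "even i")
    case True
    then have "?w = (m + 2) * (T + 1)"
      using * unfolding T_def[symmetric] by (simp add: swap_pairs_def algebra_simps)
    then show ?thesis using True by (simp add: T_def)
  next
    case False
    then have "?w + (m + 2) = (m + 2) * T"
      using * unfolding T_def[symmetric] by (simp add: swap_pairs_def)
    then have "?w = (m + 2) * (T - 1)"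
      unfolding diff_mult_distrib2 by simp
    then show ?thesis using False by (simp add: T_def)
  qed
qed

lemma weight_col:
  assumes "j < m"
  shows "weight (complete_tripartite 1 m m) (tripartite_label (Suc m)) (2, j) =
    (m + 2) * \<Sum>{..<Suc m}"
proof -
  have "weight (complete_tripartite 1 m m) (tripartite_label (Suc m)) (2, j) =
      (\<Sum>i<Suc m. latin_entry (Suc m) i (Suc j))"
    by (subst weight_cells[OF incident_col[OF assms]])
      (simp add: cell_label_def flip: sum.cartesian_product)
  then show ?thesis by (simp only: sum_latin_cols) simp
qed

text \<open>The apex collects row 0 and column 0. The swap only permutes column 0, so both lines
  keep the common sum.\<close>

lemma weight_apex:
  assumes "even m"
  shows "weight (complete_tripartite 1 m m) (tripartite_label (Suc m)) (0, 0) =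
    (m + 2) * (2 * \<Sum>{..<Suc m})"
proof -
  let ?n = "Suc m"
  have n: "odd ?n" using assms by simp
  have zero: "cell_label ?n 0 0 = 0"
    by (simp add: cell_label_def latin_entry_def swap_pairs_def)
  \<comment> \<open>As the corner has label 0, both sums may be extended to include it.\<close>
  have drop0: "(\<Sum>i=1..<?n. F i) = (\<Sum>i<?n. F i)" if "F 0 = 0" for F :: "nat \<Rightarrow> nat"
    using that by (intro sum.mono_neutral_left) (auto simp: Suc_le_eq)
  have "weight (complete_tripartite 1 m m) (tripartite_label ?n) (0, 0) =
      (\<Sum>j=1..<?n. cell_label ?n 0 j) + (\<Sum>i=1..<?n. cell_label ?n i 0)"
    by (subst weight_cells[OF incident_apex], subst sum.union_disjoint)
      (auto simp flip: sum.cartesian_product)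
  also have "\<dots> = (\<Sum>j<?n. cell_label ?n 0 j) + (\<Sum>i<?n. cell_label ?n i 0)"
    by (simp only: drop0 zero)
  also have "(\<Sum>j<?n. cell_label ?n 0 j) = (\<Sum>j<?n. latin_entry ?n 0 j)"
    by (rule sum.cong) (auto simp: cell_label_def swap_pairs_def)
  also have "\<dots> = (m + 2) * \<Sum>{..<?n}"
    using sum_latin_rows[OF n, of 0] by simp
  also have "(\<Sum>i<?n. cell_label ?n i 0) = (\<Sum>i<?n. (m + 2) * swap_pairs i)"
    using swap_pairs_lt[OF n]
    by (intro sum.cong) (auto simp: cell_label_def latin_entry_col0)
  also have "\<dots> = (m + 2) * (\<Sum>i<?n. swap_pairs i)"
    by (simp only: sum_distrib_left)
  also have "(\<Sum>i<?n. swap_pairs i) = \<Sum>{..<?n}"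
    using swap_pairs_lt[OF n]
    by (intro sum_inj_on_lessThan inj_on_subset[OF inj_swap_pairs]) auto
  finally show ?thesis by (simp add: algebra_simps)
qed

text \<open>This table of weights by part serves both the properness of the coloring and the count
  of colors.\<close>

lemma weight_cases:
  assumes "even m" "z \<in> verts (complete_tripartite 1 m m)"
  defines "T \<equiv> \<Sum>{..<Suc m}"
    and "w \<equiv> weight (complete_tripartite 1 m m) (tripartite_label (Suc m)) z"
  shows "fst z = 0 \<and> w = (m + 2) * (2 * T) \<or>
    fst z = 1 \<and> (w = (m + 2) * (T + 1) \<or> w = (m + 2) * (T - 1)) \<or>
    fst z = 2 \<and> w = (m + 2) * T"
proof -
  consider "z = (0, 0)" | i where "z = (1, i)" "i < m" | j where "z = (2, j)" "j < m"
    using assms(2) by (auto simp: complete_tripartite_def)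
  then show ?thesis
  proof cases
    case 1
    then show ?thesis
      unfolding w_def T_def using weight_apex[OF assms(1)] by simp
  next
    case (2 i)
    then show ?thesis
      unfolding w_def T_def by (simp only: weight_row[OF assms(1)] split: if_split) simp
  next
    case (3 j)
    then show ?thesis
      unfolding w_def T_def by (simp only: weight_col) simp
  qed
qed

text \<open>For this sum \<open>T\<close>, the bound puts \<open>2 * T\<close> above
  \<open>T + 1\<close> and keeps \<open>T - 1\<close> strictly below \<open>T\<close>.\<close>

lemma sum_lessThan_ge_3:
  assumes "m \<ge> 2"
  shows "\<Sum>{..<Suc m} \<ge> 3"
proof -
  have "\<Sum>{1, 2} \<le> \<Sum>{..<Suc m}"
    using assms by (intro sum_mono2) auto
  then show ?thesis by simp
qed

section \<open>The labeling is local antimagic, and the two bounds\<close>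

lemma tripartite_label_antimagic:
  assumes "m \<ge> 2" "even m"
  shows "local_antimagic_labeling (complete_tripartite 1 m m) (tripartite_label (Suc m))"
  unfolding local_antimagic_labeling_def
proof (intro conjI allI impI)
  let ?G = "complete_tripartite 1 m m" and ?n = "Suc m"
  let ?D = "{..<?n} \<times> {..<?n} - {(0, 0)}"
  have inj: "inj_on cell_edge ?D" by (rule inj_on_subset[OF inj_cell_edge]) simp
  have "card (edges ?G) = ?n * ?n - 1"
    unfolding edges_complete_tripartite card_image[OF inj] by simp
  \<comment> \<open>Pulled back along \<open>cell_edge\<close>, the labeling is the array itself, so
    its bijectivity transfers to the edges.\<close>
  moreover have "bij_betw (tripartite_label ?n \<circ> cell_edge) ?D {1..?n * ?n - 1}"
    using bij_betw_cell_label[of ?n] assms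
    by (subst bij_betw_cong[where g = "\<lambda>(i, j). cell_label ?n i j"])
      (auto simp: tripartite_label_def)
  ultimately show "bij_betw (tripartite_label ?n) (edges ?G) {1..card (edges ?G)}"
    using bij_betw_comp_iff[OF inj_on_imp_bij_betw[OF inj]] by (metis edges_complete_tripartite)
next
  let ?G = "complete_tripartite 1 m m"
  let ?w = "weight ?G (tripartite_label (Suc m))"
  define T where "T = \<Sum>{..<Suc m}"
  have T: "T \<ge> 3" unfolding T_def using assms(1) by (rule sum_lessThan_ge_3)
  fix u v assume "{u, v} \<in> edges ?G"
  then obtain x y where xy: "{u, v} = {x, y}" "x \<in> verts ?G" "y \<in> verts ?G" "fst x \<noteq> fst y"
    unfolding mem_edges_complete_tripartite_iff by blast
  \<comment> \<open>The common factor \<open>m + 2\<close> is positive and cancels, leaving a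
    comparison of small multiples and shifts of \<open>T\<close>.\<close>
  have "?w x \<noteq> ?w y"
    using weight_cases[OF assms(2) xy(2), folded T_def] weight_cases[OF assms(2) xy(3), folded T_def]
      xy(4) T
    by (elim disjE conjE) (simp_all only: mult_cancel1, auto)
  then show "?w u \<noteq> ?w v"
    using xy(1) by (metis doubleton_eq_iff)
qed

lemma card_weights_tripartite_label:
  assumes "even m"
  shows "card (weight (complete_tripartite 1 m m) (tripartite_label (Suc m))
    ` verts (complete_tripartite 1 m m)) \<le> 4"
proof -
  define T where "T = \<Sum>{..<Suc m}"
  let ?S = "{(m + 2) * (2 * T), (m + 2) * (T + 1), (m + 2) * (T - 1), (m + 2) * T}"
  have "weight (complete_tripartite 1 m m) (tripartite_label (Suc m))
      ` verts (complete_tripartite 1 m m) \<subseteq> ?S"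
  proof (rule image_subsetI)
    fix z assume "z \<in> verts (complete_tripartite 1 m m)"
    then show "weight (complete_tripartite 1 m m) (tripartite_label (Suc m)) z \<in> ?S"
      using weight_cases[OF assms, folded T_def] by blast
  qed
  then have "card (weight (complete_tripartite 1 m m) (tripartite_label (Suc m))
      ` verts (complete_tripartite 1 m m)) \<le> card ?S"
    by (intro card_mono) auto
  also have "card {a, b, c, d} \<le> 4" for a b c d :: nat
    by (simp add: card_insert_if)
  finally show ?thesis .
qed

lemma card_weights_ge_3:
  assumes "a > 0" "b > 0" "c > 0" "local_antimagic_labeling (complete_tripartite a b c) f"
  shows "card (weight (complete_tripartite a b c) f ` verts (complete_tripartite a b c)) \<ge> 3"
proof -
  let ?G = "complete_tripartite a b c"
  let ?w = "weight ?G f"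
  have V: "(0, 0) \<in> verts ?G" "(1, 0) \<in> verts ?G" "(2, 0) \<in> verts ?G"
    using assms by (auto simp: complete_tripartite_def)
  have adj: "?w u \<noteq> ?w v" if "u \<in> verts ?G" "v \<in> verts ?G" "fst u \<noteq> fst v" for u v
  proof -
    have "{u, v} \<in> edges ?G"
      using that unfolding mem_edges_complete_tripartite_iff by blast
    then show ?thesis using assms(4) unfolding local_antimagic_labeling_def by blast
  qed
  \<comment> \<open>One vertex from each part gives a triangle, whose weights are pairwise
    distinct.\<close>
  have "card {?w (0, 0), ?w (1, 0), ?w (2, 0)} = 3"
    using adj[OF V(1) V(2)] adj[OF V(1) V(3)] adj[OF V(2) V(3)] by simp
  moreover have "finite (?w ` verts ?G)"
    by (simp add: complete_tripartite_def)
  moreover have "{?w (0, 0), ?w (1, 0), ?w (2, 0)} \<subseteq> ?w ` verts ?G" using V by blast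
  ultimately show ?thesis using card_mono by metis
qed

theorem theorem2p9:
  fixes m :: nat
  assumes "m \<ge> 2" and "even m"
  shows "3 \<le> chi_la (complete_tripartite 1 m m) \<and> chi_la (complete_tripartite 1 m m) \<le> 4"
proof
  let ?G = "complete_tripartite 1 m m"
  let ?S = "{card (weight ?G f ` verts ?G) | f. local_antimagic_labeling ?G f}"
  have mem: "card (weight ?G (tripartite_label (Suc m)) ` verts ?G) \<in> ?S"
    using tripartite_label_antimagic[OF assms] by blast
  \<comment> \<open>A nonempty set of naturals attains its infimum, so the lower bound for every
    labeling passes to \<open>chi_la\<close>.\<close>
  then have "chi_la ?G \<in> ?S"
    unfolding chi_la_def by (intro Inf_nat_def1) blast
  then show "3 \<le> chi_la ?G"
    using card_weights_ge_3[of 1 m m] assms by auto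
  have "chi_la ?G \<le> card (weight ?G (tripartite_label (Suc m)) ` verts ?G)"
    unfolding chi_la_def using mem by (intro cInf_lower) auto
  then show "chi_la ?G \<le> 4"
    using card_weights_tripartite_label[OF assms(2)] by linarith
qed

end
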